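(* A group $G$ is Malcev $\mathbb Q$-complete if and only if it is pronilpotent and $0$-local.
   Context: For a group $G$ with commutator $(x,y)=xyx^{-1}y^{-1}$, the lower central series is $G^1=G$, $G^i=(G^{i-1},G)$ for $i\ge2$. $G$ is pronilpotent if the natural map $G\to\varprojlim_n G/G^n$ is an isomorphism. $G$ is $0$-local (uniquely divisible, rational) if for every integer $n\ge1$ the map $G\to G$, $g\mapsto g^n$, is a bijection. $G$ is Malcev $\mathbb Q$-complete if it is pronilpotent and for each $n\ge1$ the abelian group $G^n/G^{n+1}$ is a $\mathbb Q$-vector space. *)

theory Defs
  imports "HOL-Algebra.Algebra" "HOL-Algebra.Algebraic_Closure_Type"
begin

text \<open>The group commutator is \<open>(x, y) = x y x\<inverse> y\<inverse>\<close>.\<close>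

definition commutator_subgroup :: "('a, 'b) monoid_scheme \<Rightarrow> 'a set \<Rightarrow> 'a set \<Rightarrow> 'a set"
  where "commutator_subgroup G H K =
    generate G {x \<otimes>\<^bsub>G\<^esub> y \<otimes>\<^bsub>G\<^esub> inv\<^bsub>G\<^esub> x \<otimes>\<^bsub>G\<^esub> inv\<^bsub>G\<^esub> y | x y. x \<in> H \<and> y \<in> K}"

text \<open>The series is indexed from \<open>1\<close>; the value at \<open>0\<close> is a dummy and is never used.\<close>

fun lower_central :: "('a, 'b) monoid_scheme \<Rightarrow> nat \<Rightarrow> 'a set"
  where
    "lower_central G 0 = carrier G"
  | "lower_central G (Suc 0) = carrier G"
  | "lower_central G (Suc (Suc n)) = commutator_subgroup G (lower_central G (Suc n)) (carrier G)"

text \<open>For \<open>i \<le> j\<close>, \<open>\<phi> i j\<close> is the transition map \<open>A j \<rightarrow> A i\<close>.\<close>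

definition inverse_limit ::
    "nat set \<Rightarrow> (nat \<Rightarrow> ('a, 'b) monoid_scheme) \<Rightarrow> (nat \<Rightarrow> nat \<Rightarrow> 'a \<Rightarrow> 'a) \<Rightarrow> (nat \<Rightarrow> 'a) monoid"
  where "inverse_limit I A \<phi> = (product_group I A)
    \<lparr>carrier := {x \<in> carrier (product_group I A). \<forall>i\<in>I. \<forall>j\<in>I. i \<le> j \<longrightarrow> \<phi> i j (x j) = x i}\<rparr>"

text \<open>The projection \<open>G/H \<rightarrow> G/K\<close> for \<open>H \<le> K\<close> sends a coset \<open>C\<close> of \<open>H\<close> to the set product \<open>K C\<close>,
  which is the coset of \<open>K\<close> containing \<open>C\<close>:\<close>

lemma (in group) set_mult_rcos_of_smaller:
  assumes "subgroup H G" "subgroup K G" "H \<subseteq> K" "g \<in> carrier G"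
  shows "K <#> (H #> g) = K #> g"
proof -
  have "K <#> H = K"
  proof
    show "K <#> H \<subseteq> K"
      using assms by (auto simp: set_mult_def intro: subgroup.m_closed)
    show "K \<subseteq> K <#> H"
    proof
      fix k assume "k \<in> K"
      moreover have "k = k \<otimes> \<one>"
        using assms(2) \<open>k \<in> K\<close> by (simp add: subgroup.mem_carrier)
      ultimately show "k \<in> K <#> H"
        using subgroup.one_closed[OF assms(1)] unfolding set_mult_def by blast
    qed
  qed
  then show ?thesis
    using assms by (simp add: setmult_rcos_assoc subgroup.subset)
qed

definition nilpotent_completion :: "('a, 'b) monoid_scheme \<Rightarrow> (nat \<Rightarrow> 'a set) monoid"
  where "nilpotent_completion G =
    inverse_limit {1..} (\<lambda>n. G Mod lower_central G n) (\<lambda>n m C. lower_central G n <#>\<^bsub>G\<^esub> C)"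

definition pronilpotent :: "('a, 'b) monoid_scheme \<Rightarrow> bool"
  where "pronilpotent G \<longleftrightarrow>
    (\<lambda>g. \<lambda>n\<in>{1..}. lower_central G n #>\<^bsub>G\<^esub> g) \<in> iso G (nilpotent_completion G)"

definition zero_local :: "('a, 'b) monoid_scheme \<Rightarrow> bool"
  where "zero_local G \<longleftrightarrow>
    (\<forall>n::nat. n \<ge> 1 \<longrightarrow> bij_betw (\<lambda>g. g [^]\<^bsub>G\<^esub> n) (carrier G) (carrier G))"

text \<open>A multiplicatively written group is a rational vector space if it is the additive group of
  some module over the field of rationals. The ring multiplication and unit that the record
  \<open>module\<close> inherits from \<open>ring\<close> play no role.\<close>

definition is_rat_vector_space :: "('a, 'b) monoid_scheme \<Rightarrow> bool"
  where "is_rat_vector_space A \<longleftrightarrow>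
    (\<exists>M :: (rat, 'a) module. module (ring_of_type_algebra :: rat ring) M \<and>
       carrier M = carrier A \<and> (\<oplus>\<^bsub>M\<^esub>) = (\<otimes>\<^bsub>A\<^esub>) \<and> \<zero>\<^bsub>M\<^esub> = \<one>\<^bsub>A\<^esub>)"

definition malcev_rat_complete :: "('a, 'b) monoid_scheme \<Rightarrow> bool"
  where "malcev_rat_complete G \<longleftrightarrow> pronilpotent G \<and>
    (\<forall>n\<ge>1. is_rat_vector_space (G\<lparr>carrier := lower_central G n\<rparr> Mod lower_central G (n + 1)))"

end

theory Submission
  imports Defs
begin

text \<open>The group \<open>G\<^sup>n\<close> is central modulo \<open>G\<^sup>n\<^sup>+\<^sup>1\<close>, so that \<open>(y x)\<^sup>m \<equiv> y\<^sup>m x\<^sup>m\<close> modulo \<open>G\<^sup>n\<^sup>+\<^sup>1\<close> for \<open>x \<in> G\<^sup>n\<close>.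
  If \<open>G\<close> is pronilpotent and the factors \<open>G\<^sup>k/G\<^sup>k\<^sup>+\<^sup>1\<close> with \<open>k \<ge> n\<close> are divisible, this allows an
  approximate \<open>m\<close>-th root in \<open>G\<^sup>n\<close> of an element of \<open>G\<^sup>n\<close> to be improved by one step of the series at
  a time; the approximations converge to an exact root in \<open>G\<^sup>n\<close>. With \<open>n = 1\<close> this makes a Malcev
  complete group divisible, and torsion-freeness of the factors makes roots unique. Conversely, if
  \<open>G\<close> is \<open>0\<close>-local, then \<open>(x, v\<^sup>m) \<equiv> (x, v)\<^sup>m\<close> shows that the factors are divisible; if
  \<open>z\<^sup>m \<in> G\<^sup>n\<^sup>+\<^sup>1\<close>, then \<open>z\<^sup>m\<close> has an \<open>m\<close>-th root in \<open>G\<^sup>n\<^sup>+\<^sup>1\<close>, which by uniqueness is \<open>z\<close>.\<close>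

section \<open>Rational vector spaces as 0-local abelian groups\<close>

lemma ring_of_rat_simps [simp]:
  "carrier (ring_of_type_algebra :: rat ring) = UNIV"
  "(\<oplus>\<^bsub>(ring_of_type_algebra :: rat ring)\<^esub>) = (+)"
  "(\<otimes>\<^bsub>(ring_of_type_algebra :: rat ring)\<^esub>) = (*)"
  "\<one>\<^bsub>(ring_of_type_algebra :: rat ring)\<^esub> = 1"
  "\<zero>\<^bsub>(ring_of_type_algebra :: rat ring)\<^esub> = 0"
  by (simp_all add: ring_of_type_algebra_def)

text \<open>The \<open>n\<close>-th power is scalar multiplication by \<open>n\<close>, with scalar
  multiplication by \<open>1/n\<close> as its inverse.\<close>

lemma is_rat_vector_space_imp_zero_local:
  assumes "is_rat_vector_space A"
  shows "zero_local A"
proof -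
  let ?R = "ring_of_type_algebra :: rat ring"
  obtain M :: "(rat, 'a) module" where M: "module ?R M" "carrier M = carrier A"
    "(\<oplus>\<^bsub>M\<^esub>) = (\<otimes>\<^bsub>A\<^esub>)" "\<zero>\<^bsub>M\<^esub> = \<one>\<^bsub>A\<^esub>"
    using assms unfolding is_rat_vector_space_def by blast
  interpret module ?R M by (rule M(1))
  have closed: "q \<odot>\<^bsub>M\<^esub> x \<in> carrier A" if "x \<in> carrier A" for q x
    using smult_closed[of q x] that M(2) by simp
  have assoc: "p \<odot>\<^bsub>M\<^esub> (q \<odot>\<^bsub>M\<^esub> x) = (p * q) \<odot>\<^bsub>M\<^esub> x" if "x \<in> carrier A" for p q x
    using smult_assoc1[of p q x] that M(2) by simp
  have one: "1 \<odot>\<^bsub>M\<^esub> x = x" if "x \<in> carrier A" for x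
    using smult_one[of x] that M(2) by simp
  have pow: "x [^]\<^bsub>A\<^esub> n = of_nat n \<odot>\<^bsub>M\<^esub> x" if x: "x \<in> carrier A" for x and n :: nat
  proof (induction n)
    case 0
    have "0 \<odot>\<^bsub>M\<^esub> x = \<zero>\<^bsub>M\<^esub>" using smult_l_null[of x] x M(2) by simp
    then show ?case using M(4) by simp
  next
    case (Suc n)
    have "(of_nat n + 1) \<odot>\<^bsub>M\<^esub> x = (of_nat n \<odot>\<^bsub>M\<^esub> x) \<oplus>\<^bsub>M\<^esub> (1 \<odot>\<^bsub>M\<^esub> x)"
      using smult_l_distr[of "of_nat n" 1 x] x M(2) by simp
    then show ?case using Suc one[OF x] M(3) by (simp add: add.commute)
  qed
  have "bij_betw (\<lambda>x. x [^]\<^bsub>A\<^esub> n) (carrier A) (carrier A)" if "n \<ge> 1" for n :: nat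
    using that
    by (intro bij_betw_byWitness[where f' = "\<lambda>x. (1 / of_nat n) \<odot>\<^bsub>M\<^esub> x"])
      (auto simp: pow closed assoc one)
  then show ?thesis unfolding zero_local_def by blast
qed

text \<open>The scalar \<open>a/b\<close> sends \<open>x\<close> to the unique \<open>b\<close>-th
  root of \<open>x^a\<close>. The two module laws combining several scalars or vectors and powers
  reduce to comparing suitable positive powers of both sides, since taking such powers is
  injective.\<close>

lemma zero_local_imp_is_rat_vector_space:
  assumes "comm_group A" and zl: "zero_local A"
  shows "is_rat_vector_space A"
proof -
  let ?R = "ring_of_type_algebra :: rat ring"
  interpret A: comm_group A by fact
  have bij: "bij_betw (\<lambda>x. x [^]\<^bsub>A\<^esub> d) (carrier A) (carrier A)" if "d > 0" for d :: int
  proof -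
    have "nat d \<ge> 1" using that by simp
    then have "bij_betw (\<lambda>x. x [^]\<^bsub>A\<^esub> nat d) (carrier A) (carrier A)"
      using zl unfolding zero_local_def by blast
    moreover have "x [^]\<^bsub>A\<^esub> nat d = x [^]\<^bsub>A\<^esub> d" for x
      using that int_pow_int[of A x "nat d"] by simp
    ultimately show ?thesis by simp
  qed
  \<comment> \<open>\<open>quotient_of\<close> picks the reduced fraction with positive denominator,
    so that \<open>s\<close> does not depend on a choice of fraction.\<close>
  define s :: "rat \<Rightarrow> 'a \<Rightarrow> 'a" where
    "s q x = the_inv_into (carrier A) (\<lambda>y. y [^]\<^bsub>A\<^esub> snd (quotient_of q)) (x [^]\<^bsub>A\<^esub> fst (quotient_of q))"
    for q x
  have s_closed: "s q x \<in> carrier A" if "x \<in> carrier A" for q x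
    using bij_betw_the_inv_into[OF bij[OF quotient_of_denom_pos'[of q]]] that
    by (auto simp: s_def bij_betw_def)
  have s_pow: "s q x [^]\<^bsub>A\<^esub> snd (quotient_of q) = x [^]\<^bsub>A\<^esub> fst (quotient_of q)"
    if "x \<in> carrier A" for q x
    using f_the_inv_into_f_bij_betw[OF bij[OF quotient_of_denom_pos'[of q]]] that
    by (simp add: s_def)
  \<comment> \<open>Any fraction \<open>n/d\<close> with \<open>d > 0\<close> representing
    \<open>q\<close> determines \<open>s q x\<close>, so the module laws can be checked with
    convenient common denominators. With \<open>a/b\<close> the reduced form,
    \<open>a * d = n * b\<close>, and both candidates have the same \<open>b * d\<close>-th
    power.\<close>
  have s_unique: "s q x = y"
    if "x \<in> carrier A" "y \<in> carrier A" "d > 0" "q * of_int d = of_int n"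
      "y [^]\<^bsub>A\<^esub> d = x [^]\<^bsub>A\<^esub> n" for q x y n d
  proof -
    obtain a b where ab: "quotient_of q = (a, b)" by force
    have b: "b > 0" using quotient_of_denom_pos[OF ab] .
    have "of_int a * of_int d = (of_int n * of_int b :: rat)"
      using that(4) quotient_of_div[OF ab] b by (simp add: field_simps)
    then have *: "a * d = n * b" by (metis of_int_eq_iff of_int_mult)
    have "s q x [^]\<^bsub>A\<^esub> (b * d) = (s q x [^]\<^bsub>A\<^esub> b) [^]\<^bsub>A\<^esub> d"
      using that s_closed by (simp add: A.int_pow_pow)
    also have "\<dots> = x [^]\<^bsub>A\<^esub> (a * d)"
      using s_pow[of x q] ab that by (simp add: A.int_pow_pow)
    also have "\<dots> = (x [^]\<^bsub>A\<^esub> n) [^]\<^bsub>A\<^esub> b"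
      using * that by (simp add: A.int_pow_pow)
    also have "\<dots> = y [^]\<^bsub>A\<^esub> (b * d)"
      using that by (simp add: A.int_pow_pow mult.commute flip: that(5))
    finally show ?thesis
      using bij[of "b * d"] b that s_closed unfolding bij_betw_def inj_on_def by simp
  qed
  have s_eq: "s q x [^]\<^bsub>A\<^esub> d = x [^]\<^bsub>A\<^esub> n"
    if *: "x \<in> carrier A" "d > 0" "q * of_int d = of_int n" for q x n d
  proof -
    obtain y where y: "y \<in> carrier A" "y [^]\<^bsub>A\<^esub> d = x [^]\<^bsub>A\<^esub> n"
      using bij[OF *(2)] *(1) unfolding bij_betw_def by (metis A.int_pow_closed imageE)
    then show ?thesis using s_unique[of x y d q n] * by simp
  qed
  have frac: "\<exists>n d. d > 0 \<and> q * of_int d = of_int n" for q :: rat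
  proof -
    obtain a b where ab: "quotient_of q = (a, b)" by force
    have b: "b > 0" using quotient_of_denom_pos[OF ab] .
    show ?thesis
      by (rule exI[of _ a], rule exI[of _ b]) (use quotient_of_div[OF ab] b in simp)
  qed
  define M :: "(rat, 'a) module" where
    "M = \<lparr>carrier = carrier A, monoid.mult = (\<lambda>x y. x), one = \<one>\<^bsub>A\<^esub>,
          ring.zero = \<one>\<^bsub>A\<^esub>, add = (\<otimes>\<^bsub>A\<^esub>), module.smult = s\<rparr>"
  have "module ?R M"
  proof (rule moduleI)
    show "cring ?R" by (rule cring_from_type_algebra)
    show "abelian_group M"
      by (rule abelian_groupI)
        (use A.l_inv_ex in \<open>auto simp: M_def A.m_ac\<close>)
  next
    fix q x assume "q \<in> carrier ?R" "x \<in> carrier M"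
    then show "q \<odot>\<^bsub>M\<^esub> x \<in> carrier M" by (simp add: M_def s_closed)
  next
    fix p q :: rat and x assume "x \<in> carrier M"
    then have x: "x \<in> carrier A" by (simp add: M_def)
    obtain a b where p: "b > 0" "p * of_int b = of_int a" using frac by blast
    obtain c d where q: "d > 0" "q * of_int d = of_int c" using frac by blast
    have eq: "(p + q) * of_int (b * d) = of_int (a * d + c * b)"
      by (simp add: algebra_simps flip: p(2) q(2))
    have "s p x [^]\<^bsub>A\<^esub> (b * d) = x [^]\<^bsub>A\<^esub> (a * d)"
      by (rule s_eq) (use x p q in \<open>simp_all add: algebra_simps flip: p(2)\<close>)
    moreover have "s q x [^]\<^bsub>A\<^esub> (b * d) = x [^]\<^bsub>A\<^esub> (c * b)"
      by (rule s_eq) (use x p q in \<open>simp_all add: algebra_simps flip: q(2)\<close>)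
    ultimately have "s (p + q) x = s p x \<otimes>\<^bsub>A\<^esub> s q x"
      using x p(1) q(1)
      by (intro s_unique[OF _ _ _ eq]) (simp_all add: s_closed A.int_pow_distrib A.int_pow_mult)
    then show "(p \<oplus>\<^bsub>?R\<^esub> q) \<odot>\<^bsub>M\<^esub> x = p \<odot>\<^bsub>M\<^esub> x \<oplus>\<^bsub>M\<^esub> q \<odot>\<^bsub>M\<^esub> x"
      by (simp add: M_def)
    have "s (p * q) x = s p (s q x)"
    proof (rule s_unique)
      show "(p * q) * of_int (b * d) = of_int (a * c)"
        by (simp add: algebra_simps flip: p(2) q(2))
      have "s p (s q x) [^]\<^bsub>A\<^esub> (b * d) = (s p (s q x) [^]\<^bsub>A\<^esub> b) [^]\<^bsub>A\<^esub> d"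
        using x by (simp add: A.int_pow_pow s_closed)
      also have "\<dots> = s q x [^]\<^bsub>A\<^esub> (a * d)"
        using s_eq[OF s_closed[OF x] p] x by (simp add: A.int_pow_pow s_closed)
      also have "\<dots> = (s q x [^]\<^bsub>A\<^esub> d) [^]\<^bsub>A\<^esub> a"
        using x by (simp add: A.int_pow_pow s_closed mult.commute)
      also have "\<dots> = x [^]\<^bsub>A\<^esub> (a * c)"
        using s_eq[OF x q] x by (simp add: A.int_pow_pow mult.commute)
      finally show "s p (s q x) [^]\<^bsub>A\<^esub> (b * d) = x [^]\<^bsub>A\<^esub> (a * c)" .
    qed (use x p q s_closed in auto)
    then show "(p \<otimes>\<^bsub>?R\<^esub> q) \<odot>\<^bsub>M\<^esub> x = p \<odot>\<^bsub>M\<^esub> (q \<odot>\<^bsub>M\<^esub> x)"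
      by (simp add: M_def)
  next
    fix q :: rat and x y assume "x \<in> carrier M" "y \<in> carrier M"
    then have xy: "x \<in> carrier A" "y \<in> carrier A" by (simp_all add: M_def)
    obtain c d where q: "d > 0" "q * of_int d = of_int c" using frac by blast
    have "s q (x \<otimes>\<^bsub>A\<^esub> y) = s q x \<otimes>\<^bsub>A\<^esub> s q y"
      by (rule s_unique[OF _ _ q])
        (use xy q in \<open>simp_all add: s_closed A.int_pow_distrib s_eq[OF _ q]\<close>)
    then show "q \<odot>\<^bsub>M\<^esub> (x \<oplus>\<^bsub>M\<^esub> y) = q \<odot>\<^bsub>M\<^esub> x \<oplus>\<^bsub>M\<^esub> q \<odot>\<^bsub>M\<^esub> y"
      by (simp add: M_def)
  next
    fix x assume "x \<in> carrier M"
    then have "s 1 x = x" by (intro s_unique[of _ _ 1 _ 1]) (auto simp: M_def)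
    then show "\<one>\<^bsub>?R\<^esub> \<odot>\<^bsub>M\<^esub> x = x" by (simp add: M_def)
  qed
  then show ?thesis
    unfolding is_rat_vector_space_def by (intro exI[of _ M]) (simp add: M_def)
qed

section \<open>Powers and products modulo a normal subgroup\<close>

lemma (in normal) coset_eq_iff:
  assumes "x \<in> carrier G" "y \<in> carrier G"
  shows "H #> x = H #> y \<longleftrightarrow> x \<otimes> inv y \<in> H"
  using assms
  by (metis is_group rcos_module rcos_self repr_independence subgroup_axioms)

lemma (in normal) coset_mult_cong:
  assumes "x \<in> carrier G" "x' \<in> carrier G" "y \<in> carrier G" "y' \<in> carrier G"
    "H #> x = H #> x'" "H #> y = H #> y'"
  shows "H #> (x \<otimes> y) = H #> (x' \<otimes> y')"
  using assms by (simp flip: rcos_sum)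

lemma (in normal) coset_pow_cong:
  assumes "x \<in> carrier G" "y \<in> carrier G" "H #> x = H #> y"
  shows "H #> (x [^] (m::nat)) = H #> (y [^] m)"
  using assms by (simp flip: FactGroup_pow)

text \<open>The cosets of \<open>x\<close> and \<open>y\<close> commute in the quotient group, where
  powers of a product of commuting elements distribute.\<close>

lemma (in normal) coset_pow_mult:
  assumes "x \<in> carrier G" "y \<in> carrier G" "H #> (x \<otimes> y) = H #> (y \<otimes> x)"
  shows "H #> ((x \<otimes> y) [^] (m::nat)) = H #> (x [^] m \<otimes> y [^] m)"
proof -
  interpret Q: group "G Mod H" by (rule factorgroup_is_group)
  have "(H #> x) <#> (H #> y) = (H #> y) <#> (H #> x)"
    using assms by (simp add: rcos_sum)
  moreover have "H #> x \<in> carrier (G Mod H)" "H #> y \<in> carrier (G Mod H)"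
    using assms by (auto simp: carrier_FactGroup)
  ultimately have "((H #> x) <#> (H #> y)) [^]\<^bsub>G Mod H\<^esub> m =
      (H #> x) [^]\<^bsub>G Mod H\<^esub> m <#> (H #> y) [^]\<^bsub>G Mod H\<^esub> m"
    using Q.pow_mult_distrib[of "H #> x" "H #> y" m] by simp
  then show ?thesis using assms(1,2) by (simp add: rcos_sum FactGroup_pow)
qed

text \<open>In the abelian quotient the power map is a homomorphism, so its injectivity amounts to a
  trivial kernel. Surjectivity and trivial kernel are then read off on representatives in
  \<open>G\<close>.\<close>

lemma (in normal) zero_local_Mod_iff:
  assumes comm: "\<And>x y. x \<in> carrier G \<Longrightarrow> y \<in> carrier G \<Longrightarrow> H #> (x \<otimes> y) = H #> (y \<otimes> x)"
  shows "zero_local (G Mod H) \<longleftrightarrow>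
    (\<forall>m::nat. m \<ge> 1 \<longrightarrow> (\<forall>c\<in>carrier G. \<exists>z\<in>carrier G. H #> (z [^] m) = H #> c) \<and>
      (\<forall>z\<in>carrier G. z [^] m \<in> H \<longrightarrow> z \<in> H))"
proof -
  interpret Q: group "G Mod H" by (rule factorgroup_is_group)
  have "bij_betw (\<lambda>C. C [^]\<^bsub>G Mod H\<^esub> m) (carrier (G Mod H)) (carrier (G Mod H)) \<longleftrightarrow>
     (\<forall>c\<in>carrier G. \<exists>z\<in>carrier G. H #> (z [^] m) = H #> c) \<and>
      (\<forall>z\<in>carrier G. z [^] m \<in> H \<longrightarrow> z \<in> H)" (is "?bij \<longleftrightarrow> ?div \<and> ?tf") for m :: nat
  proof -
    have sub: "(\<lambda>C. C [^]\<^bsub>G Mod H\<^esub> m) ` carrier (G Mod H) \<subseteq> carrier (G Mod H)"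
      by auto
    have div: "(\<lambda>C. C [^]\<^bsub>G Mod H\<^esub> m) ` carrier (G Mod H) = carrier (G Mod H) \<longleftrightarrow> ?div"
    proof
      assume "(\<lambda>C. C [^]\<^bsub>G Mod H\<^esub> m) ` carrier (G Mod H) = carrier (G Mod H)"
      then have "H #> c \<in> (\<lambda>C. C [^]\<^bsub>G Mod H\<^esub> m) ` carrier (G Mod H)" if "c \<in> carrier G" for c
        using that by (auto simp: carrier_FactGroup)
      then show ?div by (fastforce simp: carrier_FactGroup FactGroup_pow)
    next
      assume ?div
      then have "carrier (G Mod H) \<subseteq> (\<lambda>C. C [^]\<^bsub>G Mod H\<^esub> m) ` carrier (G Mod H)"
        by (fastforce simp: carrier_FactGroup FactGroup_pow image_iff)
      with sub show "(\<lambda>C. C [^]\<^bsub>G Mod H\<^esub> m) ` carrier (G Mod H) = carrier (G Mod H)" by blast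
    qed
    have inj: "inj_on (\<lambda>C. C [^]\<^bsub>G Mod H\<^esub> m) (carrier (G Mod H)) \<longleftrightarrow> ?tf"
    proof
      assume *: "inj_on (\<lambda>C. C [^]\<^bsub>G Mod H\<^esub> m) (carrier (G Mod H))"
      show ?tf
      proof (intro ballI impI)
        fix z assume z: "z \<in> carrier G" "z [^] m \<in> H"
        have "(H #> z) [^]\<^bsub>G Mod H\<^esub> m = \<one>\<^bsub>G Mod H\<^esub> [^]\<^bsub>G Mod H\<^esub> m"
          using z by (simp add: FactGroup_pow coset_join2 subgroup_axioms del: one_FactGroup)
             (simp add: coset_join2 subgroup_axioms)
        then have "H #> z = H"
          using inj_onD[OF *, of "H #> z" "\<one>\<^bsub>G Mod H\<^esub>"] z Q.one_closed
          by (auto simp: carrier_FactGroup)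
        then show "z \<in> H" using z coset_join1 subgroup_axioms by blast
      qed
    next
      assume tf: ?tf
      have eqI: "H #> x = H #> y" if xy: "x \<in> carrier G" "y \<in> carrier G"
        and eq: "H #> (x [^] m) = H #> (y [^] m)" for x y
      proof -
        have "H #> ((x \<otimes> inv y) [^] m) = H #> (x [^] m \<otimes> inv y [^] m)"
          using xy by (intro coset_pow_mult comm) auto
        also have "\<dots> = H #> (y [^] m \<otimes> inv y [^] m)"
          using xy eq by (intro coset_mult_cong) auto
        also have "\<dots> = H #> \<one>"
          using xy by (simp add: nat_pow_inv)
        finally have "(x \<otimes> inv y) [^] m \<in> H"
          using xy coset_eq_iff[of "(x \<otimes> inv y) [^] m" \<one>] by simp
        then have "x \<otimes> inv y \<in> H" using tf xy by blast
        then show ?thesis using xy coset_eq_iff[of x y] by simp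
      qed
      show "inj_on (\<lambda>C. C [^]\<^bsub>G Mod H\<^esub> m) (carrier (G Mod H))"
        by (rule inj_onI, clarsimp simp: carrier_FactGroup FactGroup_pow) (rule eqI)
    qed
    show ?thesis unfolding bij_betw_def inj div by blast
  qed
  then show ?thesis unfolding zero_local_def by simp
qed

section \<open>The lower central series\<close>

context group
begin

abbreviation \<gamma> :: "nat \<Rightarrow> 'a set" where "\<gamma> \<equiv> lower_central G"

text \<open>A conjugate of a commutator is the commutator of the conjugates, and its first entry
  stays in the preceding term by the induction hypothesis.\<close>

lemma lower_central_normal: "\<gamma> n \<lhd> G"
proof (induction n rule: induct_nat_012)
  case (ge2 n)
  then interpret N: normal "\<gamma> (Suc n)" G by simp
  let ?S = "{x \<otimes> y \<otimes> inv x \<otimes> inv y | x y. x \<in> \<gamma> (Suc n) \<and> y \<in> carrier G}"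
  have "generate G ?S \<lhd> G"
  proof (rule normal_generateI)
    show "?S \<subseteq> carrier G" using N.subset by auto
  next
    fix h g assume "h \<in> ?S" and g: "g \<in> carrier G"
    then obtain x y where xy: "x \<in> \<gamma> (Suc n)" "y \<in> carrier G"
      and h: "h = x \<otimes> y \<otimes> inv x \<otimes> inv y" by blast
    have x: "x \<in> carrier G" using xy N.subset by blast
    \<comment> \<open>Cancellation in right-associated form, for the inner factors
      \<open>inv g \<otimes> g\<close> that arise when the conjugates are multiplied out.\<close>
    have "inv g \<otimes> (g \<otimes> a) = a" if "a \<in> carrier G" for a
      using g that by (simp flip: m_assoc)
    then have "g \<otimes> h \<otimes> inv g =
        (g \<otimes> x \<otimes> inv g) \<otimes> (g \<otimes> y \<otimes> inv g) \<otimes> inv (g \<otimes> x \<otimes> inv g) \<otimes> inv (g \<otimes> y \<otimes> inv g)"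
      using x xy g by (simp add: h m_assoc inv_mult_group)
    moreover have "g \<otimes> x \<otimes> inv g \<in> \<gamma> (Suc n)" using xy g by (rule_tac N.inv_op_closed2) auto
    ultimately show "g \<otimes> h \<otimes> inv g \<in> ?S" using xy g by blast
  qed
  then show ?case by (simp add: commutator_subgroup_def)
qed (simp_all add: normal_inv_iff subgroup_self)

lemma lower_central_subgroup: "subgroup (\<gamma> n) G"
  using lower_central_normal normal_imp_subgroup by blast

lemma lower_central_closed: "x \<in> \<gamma> n \<Longrightarrow> x \<in> carrier G"
  using lower_central_subgroup subgroup.mem_carrier by fast

lemma commutator_in_lower_central_Suc:
  assumes "n \<ge> 1" "x \<in> \<gamma> n" "y \<in> carrier G"
  shows "x \<otimes> y \<otimes> inv x \<otimes> inv y \<in> \<gamma> (Suc n)"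
  using assms by (cases n) (auto simp: commutator_subgroup_def intro!: generate.incl)

text \<open>Each generating commutator is the product of \<open>x\<close> and a conjugate of
  \<open>inv x\<close>, both in the normal subgroup \<open>\<gamma> n\<close>.\<close>

lemma lower_central_Suc_subset: "\<gamma> (Suc n) \<subseteq> \<gamma> n"
proof (cases n)
  case (Suc k)
  interpret N: normal "\<gamma> (Suc k)" G by (rule lower_central_normal)
  have "x \<otimes> y \<otimes> inv x \<otimes> inv y \<in> \<gamma> (Suc k)" if "x \<in> \<gamma> (Suc k)" "y \<in> carrier G" for x y
  proof -
    have "x \<otimes> (y \<otimes> inv x \<otimes> inv y) \<in> \<gamma> (Suc k)"
      using that by (intro N.m_closed N.inv_op_closed2) auto
    then show ?thesis using that by (simp add: m_assoc)
  qed
  then have "commutator_subgroup G (\<gamma> (Suc k)) (carrier G) \<subseteq> \<gamma> (Suc k)"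
    unfolding commutator_subgroup_def
    by (intro generate_subgroup_incl N.subgroup_axioms) blast
  then show ?thesis using Suc by simp
qed simp

lemma lower_central_antimono: "i \<le> j \<Longrightarrow> \<gamma> j \<subseteq> \<gamma> i"
  by (rule lift_Suc_antimono_le[of \<gamma>]) (rule lower_central_Suc_subset)

text \<open>The quotient of \<open>x \<otimes> y\<close> by \<open>y \<otimes> x\<close> is exactly
  the commutator of \<open>x\<close> and \<open>y\<close>.\<close>

lemma lower_central_coset_commute:
  assumes "n \<ge> 1" "x \<in> \<gamma> n" "y \<in> carrier G"
  shows "\<gamma> (Suc n) #> (x \<otimes> y) = \<gamma> (Suc n) #> (y \<otimes> x)"
proof -
  interpret N: normal "\<gamma> (Suc n)" G by (rule lower_central_normal)
  have "x \<in> carrier G" using assms lower_central_closed by blast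
  then show ?thesis
    using commutator_in_lower_central_Suc[OF assms] assms
    by (simp add: N.coset_eq_iff inv_mult_group m_assoc)
qed

lemma coset_lower_central_coarsen:
  assumes "i \<le> j" "x \<in> carrier G" "y \<in> carrier G" "\<gamma> j #> x = \<gamma> j #> y"
  shows "\<gamma> i #> x = \<gamma> i #> y"
  using assms lower_central_antimono[of i j]
    normal.coset_eq_iff[OF lower_central_normal, of x y] by auto

lemma lower_central_coset_pow_mult:
  assumes "n \<ge> 1" "x \<in> \<gamma> n" "y \<in> carrier G"
  shows "\<gamma> (Suc n) #> ((y \<otimes> x) [^] (m::nat)) = \<gamma> (Suc n) #> (y [^] m \<otimes> x [^] m)"
  using assms lower_central_closed
  by (intro normal.coset_pow_mult lower_central_normal lower_central_coset_commute[symmetric]) auto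

section \<open>Limits and roots in pronilpotent groups\<close>

lemma pronilpotent_separated:
  assumes "pronilpotent G" "x \<in> carrier G" "y \<in> carrier G"
    "\<And>n. n \<ge> 1 \<Longrightarrow> \<gamma> n #> x = \<gamma> n #> y"
  shows "x = y"
proof -
  have "inj_on (\<lambda>g. \<lambda>n\<in>{1..}. \<gamma> n #> g) (carrier G)"
    using assms(1) unfolding pronilpotent_def iso_def bij_betw_def by simp
  moreover have "(\<lambda>n\<in>{1..}. \<gamma> n #> x) = (\<lambda>n\<in>{1..}. \<gamma> n #> y)"
    using assms(4) by (auto intro: restrict_ext)
  ultimately show ?thesis using assms(2,3) by (auto dest: inj_onD)
qed

text \<open>This is surjectivity of the map to the completion: the cosets of the \<open>a n\<close>
  form a point of the inverse limit, and \<open>x\<close> is a preimage of it.\<close>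

lemma pronilpotent_limit:
  assumes "pronilpotent G" "\<And>n. a n \<in> carrier G"
    "\<And>n. n \<ge> 1 \<Longrightarrow> \<gamma> n #> a (Suc n) = \<gamma> n #> a n"
  obtains x where "x \<in> carrier G" "\<And>n. n \<ge> 1 \<Longrightarrow> \<gamma> n #> x = \<gamma> n #> a n"
proof -
  \<comment> \<open>Agreement of consecutive terms is telescoped: agreement modulo
    \<open>\<gamma> j\<close> implies agreement modulo the larger \<open>\<gamma> i\<close>.\<close>
  have coherent: "\<gamma> i #> a j = \<gamma> i #> a i" if "1 \<le> i" "i \<le> j" for i j
    using that(2)
  proof (induction j rule: dec_induct)
    case (step j)
    then show ?case
      using coset_lower_central_coarsen[OF step(1) _ _ assms(3)[of j]] that(1) assms(2) by simp
  qed simp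
  define C where "C = (\<lambda>n\<in>{1::nat..}. \<gamma> n #> a n)"
  have "\<gamma> i <#> C j = C i" if "1 \<le> i" "i \<le> j" for i j
    using that assms(2) lower_central_antimono lower_central_subgroup coherent[OF that]
    by (simp add: C_def set_mult_rcos_of_smaller)
  then have "C \<in> carrier (nilpotent_completion G)"
    using assms(2)
    by (auto simp: nilpotent_completion_def inverse_limit_def C_def carrier_FactGroup)
  moreover have "(\<lambda>g. \<lambda>n\<in>{1..}. \<gamma> n #> g) ` carrier G = carrier (nilpotent_completion G)"
    using assms(1) unfolding pronilpotent_def iso_def bij_betw_def by simp
  ultimately obtain x where x: "x \<in> carrier G" "C = (\<lambda>n\<in>{1..}. \<gamma> n #> x)" by blast
  have "\<gamma> n #> x = \<gamma> n #> a n" if "n \<ge> 1" for n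
    using fun_cong[OF x(2), of n] that by (simp add: C_def)
  with x(1) that show thesis by blast
qed

text \<open>Starting from \<open>\<one>\<close>, each approximation \<open>x\<close> is replaced by
  \<open>x \<otimes> z\<close>, where \<open>z\<close> is an approximate root of the error
  \<open>inv (x [^] m) \<otimes> w\<close>. The limit is a root of \<open>w\<close> by
  separatedness.\<close>

lemma pronilpotent_root_exists:
  assumes "pronilpotent G" and n: "n \<ge> 1"
    and div: "\<And>k c. k \<ge> n \<Longrightarrow> c \<in> \<gamma> k \<Longrightarrow> \<exists>z\<in>\<gamma> k. \<gamma> (Suc k) #> (z [^] (m::nat)) = \<gamma> (Suc k) #> c"
    and w: "w \<in> \<gamma> n"
  shows "\<exists>y\<in>\<gamma> n. y [^] m = w"
proof -
  have w': "w \<in> carrier G" using w lower_central_closed by blast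
  \<comment> \<open>Fixing \<open>x 0 = \<one>\<close> is what later places the limit in
    \<open>\<gamma> n\<close>. This start is valid since \<open>w\<close> is trivial modulo
    \<open>\<gamma> n\<close>.\<close>
  have "\<exists>x. \<forall>i. (x i \<in> carrier G \<and> \<gamma> (n + i) #> (x i [^] m) = \<gamma> (n + i) #> w \<and> (i = 0 \<longrightarrow> x i = \<one>)) \<and>
      \<gamma> (n + i) #> x (Suc i) = \<gamma> (n + i) #> x i"
  proof (rule dependent_nat_choice, goal_cases)
    case 1
    have "\<gamma> n #> w = \<gamma> n #> \<one>"
      using w w' normal.coset_eq_iff[OF lower_central_normal] by simp
    then show ?case by (intro exI[of _ \<one>]) simp
  next
    case (2 x i)
    interpret N: normal "\<gamma> (n + i)" G by (rule lower_central_normal)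
    interpret N': normal "\<gamma> (Suc (n + i))" G by (rule lower_central_normal)
    have x: "x \<in> carrier G" using 2 by simp
    have "\<gamma> (n + i) #> w = \<gamma> (n + i) #> (x [^] m)" using 2 by simp
    then have "w \<otimes> inv (x [^] m) \<in> \<gamma> (n + i)" using x w' N.coset_eq_iff by simp
    \<comment> \<open>Conjugation moves the error to the right of \<open>x [^] m\<close>, the side
      on which \<open>x\<close> is corrected.\<close>
    then have "inv (x [^] m) \<otimes> (w \<otimes> inv (x [^] m)) \<otimes> x [^] m \<in> \<gamma> (n + i)"
      using x by (intro N.inv_op_closed1) auto
    then have c: "inv (x [^] m) \<otimes> w \<in> \<gamma> (n + i)"
      using x w' by (simp add: m_assoc)
    then obtain z where z: "z \<in> \<gamma> (n + i)"
      "\<gamma> (Suc (n + i)) #> (z [^] m) = \<gamma> (Suc (n + i)) #> (inv (x [^] m) \<otimes> w)"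
      using div[of "n + i"] by auto
    have z': "z \<in> carrier G" using z(1) lower_central_closed by blast
    have "\<gamma> (Suc (n + i)) #> ((x \<otimes> z) [^] m) = \<gamma> (Suc (n + i)) #> (x [^] m \<otimes> z [^] m)"
      using z(1) x n by (intro lower_central_coset_pow_mult) auto
    also have "\<dots> = \<gamma> (Suc (n + i)) #> (x [^] m \<otimes> (inv (x [^] m) \<otimes> w))"
      using z(2) z' x w' by (intro N'.coset_mult_cong) auto
    also have "\<dots> = \<gamma> (Suc (n + i)) #> w"
      using x w' by (simp flip: m_assoc)
    finally have 3: "\<gamma> (Suc (n + i)) #> ((x \<otimes> z) [^] m) = \<gamma> (Suc (n + i)) #> w" .
    have "\<gamma> (n + i) #> (x \<otimes> z) = \<gamma> (n + i) #> x"
      using z z' x by (simp add: N.coset_eq_iff N.inv_op_closed2)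
    with 3 show ?case using x z' by (intro exI[of _ "x \<otimes> z"]) auto
  qed
  then obtain x where x: "\<And>i. x i \<in> carrier G" "x 0 = \<one>"
      "\<And>i. \<gamma> (n + i) #> (x i [^] m) = \<gamma> (n + i) #> w"
      "\<And>i. \<gamma> (n + i) #> x (Suc i) = \<gamma> (n + i) #> x i"
    by blast
  \<comment> \<open>The sequence is shifted so that its \<open>j\<close>-th term is accurate modulo
    \<open>\<gamma> j\<close> for \<open>j \<ge> n\<close>. For \<open>j < n\<close>, truncated
    subtraction makes both sides use \<open>x 0\<close>.\<close>
  have "\<gamma> j #> x (Suc j - n) = \<gamma> j #> x (j - n)" for j
    using x(4)[of "j - n"] by (cases "n \<le> j") (simp_all add: Suc_diff_le)
  then obtain y where y: "y \<in> carrier G" "\<And>j. j \<ge> 1 \<Longrightarrow> \<gamma> j #> y = \<gamma> j #> x (j - n)"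
    using pronilpotent_limit[OF assms(1), of "\<lambda>j. x (j - n)"] x(1) by auto
  have "\<gamma> n #> y = \<gamma> n #> \<one>" using y(2)[OF n] x(2) by simp
  then have "y \<in> \<gamma> n"
    using y(1) normal.coset_eq_iff[OF lower_central_normal] by simp
  moreover have "y [^] m = w"
  proof (rule pronilpotent_separated[OF assms(1) _ w'])
    fix j :: nat assume "j \<ge> 1"
    \<comment> \<open>Level \<open>n + j\<close> is used because there the shifted sequence has the
      term \<open>x j\<close>; the result is then coarsened to level \<open>j\<close>.\<close>
    then have "\<gamma> (n + j) #> (y [^] m) = \<gamma> (n + j) #> (x j [^] m)"
      using y x by (intro normal.coset_pow_cong lower_central_normal) auto
    with x(3)[of j] show "\<gamma> j #> (y [^] m) = \<gamma> j #> w"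
      using y(1) w' by (intro coset_lower_central_coarsen[of j "n + j"]) auto
  qed (use y in simp)
  ultimately show ?thesis by blast
qed

section \<open>Divisibility and torsion in the factors of the series\<close>

text \<open>The factor is abelian because \<open>\<gamma> n\<close> is central modulo
  \<open>\<gamma> (Suc n)\<close>, so being a rational vector space means being 0-local. Cosets
  formed in the restricted group are the same sets as in \<open>G\<close>, which allows a criterion
  in terms of \<open>G\<close> alone.\<close>

lemma lower_central_factor_rat_iff:
  assumes n: "n \<ge> 1"
  shows "is_rat_vector_space (G\<lparr>carrier := \<gamma> n\<rparr> Mod \<gamma> (n + 1)) \<longleftrightarrow>
    (\<forall>m::nat. m \<ge> 1 \<longrightarrow> (\<forall>c\<in>\<gamma> n. \<exists>z\<in>\<gamma> n. \<gamma> (Suc n) #> (z [^] m) = \<gamma> (Suc n) #> c) \<and>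
      (\<forall>z\<in>\<gamma> n. z [^] m \<in> \<gamma> (Suc n) \<longrightarrow> z \<in> \<gamma> (Suc n)))"
proof -
  let ?K = "G\<lparr>carrier := \<gamma> n\<rparr>"
  have "\<gamma> (Suc n) \<lhd> ?K"
    using normal_restrict_supergroup[OF lower_central_subgroup lower_central_normal lower_central_Suc_subset] .
  then interpret N: normal "\<gamma> (Suc n)" ?K .
  have coset: "\<gamma> (Suc n) #>\<^bsub>?K\<^esub> x = \<gamma> (Suc n) #> x" for x
    by (simp add: r_coset_def)
  have commute: "\<gamma> (Suc n) #>\<^bsub>?K\<^esub> (x \<otimes>\<^bsub>?K\<^esub> y) = \<gamma> (Suc n) #>\<^bsub>?K\<^esub> (y \<otimes>\<^bsub>?K\<^esub> x)"
    if "x \<in> carrier ?K" "y \<in> carrier ?K" for x y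
    using that lower_central_coset_commute[OF n] lower_central_closed by (simp add: coset)
  have "comm_group (?K Mod \<gamma> (Suc n))"
  proof (rule group.group_comm_groupI[OF N.factorgroup_is_group])
    fix C D assume "C \<in> carrier (?K Mod \<gamma> (Suc n))" "D \<in> carrier (?K Mod \<gamma> (Suc n))"
    then obtain x y where "x \<in> carrier ?K" "y \<in> carrier ?K"
      "C = \<gamma> (Suc n) #>\<^bsub>?K\<^esub> x" "D = \<gamma> (Suc n) #>\<^bsub>?K\<^esub> y"
      unfolding carrier_FactGroup by blast
    then show "C \<otimes>\<^bsub>?K Mod \<gamma> (Suc n)\<^esub> D = D \<otimes>\<^bsub>?K Mod \<gamma> (Suc n)\<^esub> C"
      using commute unfolding mult_FactGroup by (metis N.rcos_sum)
  qed
  then have "is_rat_vector_space (?K Mod \<gamma> (Suc n)) \<longleftrightarrow> zero_local (?K Mod \<gamma> (Suc n))"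
    using is_rat_vector_space_imp_zero_local zero_local_imp_is_rat_vector_space by blast
  also have "\<dots> \<longleftrightarrow> (\<forall>m::nat. m \<ge> 1 \<longrightarrow>
      (\<forall>c\<in>\<gamma> n. \<exists>z\<in>\<gamma> n. \<gamma> (Suc n) #> (z [^] m) = \<gamma> (Suc n) #> c) \<and>
      (\<forall>z\<in>\<gamma> n. z [^] m \<in> \<gamma> (Suc n) \<longrightarrow> z \<in> \<gamma> (Suc n)))"
    using N.zero_local_Mod_iff[OF commute] by (simp add: coset flip: nat_pow_consistent)
  finally show ?thesis by simp
qed

text \<open>Elements of \<open>\<gamma> n\<close> with an \<open>m\<close>-th root modulo
  \<open>\<gamma> (Suc n)\<close> form a subgroup, so for \<open>n \<ge> 2\<close> it suffices to
  treat the generating commutators.\<close>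

lemma lower_central_factor_divisible:
  assumes surj: "\<And>g. g \<in> carrier G \<Longrightarrow> \<exists>v\<in>carrier G. v [^] (m::nat) = g"
    and "n \<ge> 1" "c \<in> \<gamma> n"
  shows "\<exists>z\<in>\<gamma> n. \<gamma> (Suc n) #> (z [^] m) = \<gamma> (Suc n) #> c"
\<comment> \<open>The first term is not generated by commutators; there an exact root in
  \<open>G\<close> serves.\<close>
proof (cases "n = 1")
  case True
  then show ?thesis using surj[of c] assms(3) by auto
next
  case False
  then have "n = Suc (Suc (n - 2))" using assms(2) by arith
  then obtain k where n: "n = Suc (Suc k)" ..
  interpret N: normal "\<gamma> (Suc n)" G by (rule lower_central_normal)
  interpret M: normal "\<gamma> n" G by (rule lower_central_normal)
  define D where "D = {c \<in> \<gamma> n. \<exists>z\<in>\<gamma> n. \<gamma> (Suc n) #> (z [^] m) = \<gamma> (Suc n) #> c}"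
  have "subgroup D G"
  proof (rule subgroupI)
    show "D \<subseteq> carrier G" using M.subset by (auto simp: D_def)
    have "\<one> \<in> D" using M.one_closed by (auto simp: D_def intro!: bexI[of _ \<one>])
    then show "D \<noteq> {}" by blast
  next
    fix a assume "a \<in> D"
    then obtain z where z: "a \<in> \<gamma> n" "z \<in> \<gamma> n" "\<gamma> (Suc n) #> (z [^] m) = \<gamma> (Suc n) #> a"
      by (auto simp: D_def)
    then have "\<gamma> (Suc n) #> (inv z [^] m) = \<gamma> (Suc n) #> inv a"
      by (simp add: lower_central_closed nat_pow_inv flip: N.rcos_inv)
    with z show "inv a \<in> D" by (auto simp: D_def)
  next
    fix a b assume "a \<in> D" "b \<in> D"
    then obtain z y where z: "a \<in> \<gamma> n" "z \<in> \<gamma> n" "\<gamma> (Suc n) #> (z [^] m) = \<gamma> (Suc n) #> a"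
      and y: "b \<in> \<gamma> n" "y \<in> \<gamma> n" "\<gamma> (Suc n) #> (y [^] m) = \<gamma> (Suc n) #> b"
      by (auto simp: D_def)
    have "\<gamma> (Suc n) #> ((z \<otimes> y) [^] m) = \<gamma> (Suc n) #> (z [^] m \<otimes> y [^] m)"
      using z y assms(2) by (intro lower_central_coset_pow_mult) (auto simp: lower_central_closed)
    also have "\<dots> = \<gamma> (Suc n) #> (a \<otimes> b)"
      using z y by (intro N.coset_mult_cong) (auto simp: lower_central_closed)
    finally show "a \<otimes> b \<in> D" using z y by (auto simp: D_def)
  qed
  moreover have "x \<otimes> y \<otimes> inv x \<otimes> inv y \<in> D" if x: "x \<in> \<gamma> (Suc k)" and y: "y \<in> carrier G" for x y
  proof -
    \<comment> \<open>The root is extracted in the second entry: the commutator of \<open>x\<close>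
      and \<open>v\<close> is the required root of that of \<open>x\<close> and \<open>y\<close>
      modulo \<open>\<gamma> (Suc n)\<close>.\<close>
    obtain v where v: "v \<in> carrier G" "v [^] m = y" using surj[OF y] by blast
    have x': "x \<in> carrier G" using x lower_central_closed by blast
    define z where "z = x \<otimes> v \<otimes> inv x \<otimes> inv v"
    have z: "z \<in> \<gamma> n"
      unfolding z_def n using x v by (intro commutator_in_lower_central_Suc) auto
    have z': "z \<in> carrier G" using z lower_central_closed by blast
    \<comment> \<open>\<open>x v\<^sup>m x\<inverse> = (x v x\<inverse>)\<^sup>m = (z v)\<^sup>m\<close>, and \<open>z\<close> is central modulo \<open>\<gamma> (Suc n)\<close>.\<close>
    have conj: "(x \<otimes> v \<otimes> inv x) [^] i = x \<otimes> v [^] i \<otimes> inv x" for i :: nat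
      by (induction i) (use x' v in \<open>simp_all add: m_assoc inv_solve_left'\<close>)
    have zv: "z \<otimes> v = x \<otimes> v \<otimes> inv x"
      using x' v by (simp add: z_def m_assoc)
    have "\<gamma> (Suc n) #> (x \<otimes> y \<otimes> inv x) = \<gamma> (Suc n) #> ((z \<otimes> v) [^] m)"
      using conj[of m] v by (simp add: zv)
    also have "\<dots> = \<gamma> (Suc n) #> (z [^] m \<otimes> y)"
      using N.coset_pow_mult[OF z' v(1) lower_central_coset_commute[OF assms(2) z v(1)]] v(2)
      by simp
    finally have "\<gamma> (Suc n) #> (x \<otimes> y \<otimes> inv x \<otimes> inv y) = \<gamma> (Suc n) #> (z [^] m \<otimes> y \<otimes> inv y)"
      using x' y z' by (intro N.coset_mult_cong[where y = "inv y" and y' = "inv y"]) auto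
    then have "\<gamma> (Suc n) #> (z [^] m) = \<gamma> (Suc n) #> (x \<otimes> y \<otimes> inv x \<otimes> inv y)"
      using z' y by (simp add: m_assoc)
    moreover have "x \<otimes> y \<otimes> inv x \<otimes> inv y \<in> \<gamma> n"
      unfolding n using x y by (intro commutator_in_lower_central_Suc) auto
    ultimately show ?thesis using z by (auto simp: D_def)
  qed
  ultimately have "\<gamma> n \<subseteq> D"
    unfolding n lower_central.simps commutator_subgroup_def
    by (intro generate_subgroup_incl) auto
  then show ?thesis using assms(3) by (auto simp: D_def)
qed

section \<open>The two implications\<close>

text \<open>For injectivity, elements with equal \<open>m\<close>-th powers are shown congruent
  modulo each \<open>\<gamma> n\<close> by induction, using torsion-freeness of one factor per step.
  Surjectivity is the existence of roots at level 1.\<close>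

lemma malcev_rat_complete_imp_zero_local:
  assumes "malcev_rat_complete G"
  shows "zero_local G"
  unfolding zero_local_def bij_betw_def
proof (intro allI impI conjI)
  fix m :: nat assume m: "m \<ge> 1"
  have pn: "pronilpotent G" using assms malcev_rat_complete_def by blast
  have div: "\<exists>z\<in>\<gamma> k. \<gamma> (Suc k) #> (z [^] m) = \<gamma> (Suc k) #> c" if "k \<ge> 1" "c \<in> \<gamma> k" for k c
    using assms that m lower_central_factor_rat_iff unfolding malcev_rat_complete_def by blast
  have tf: "z \<in> \<gamma> (Suc k)" if "k \<ge> 1" "z \<in> \<gamma> k" "z [^] m \<in> \<gamma> (Suc k)" for k z
    using assms that m lower_central_factor_rat_iff unfolding malcev_rat_complete_def by blast
  show "inj_on (\<lambda>g. g [^] m) (carrier G)"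
  proof (rule inj_onI)
    fix g h assume gh: "g \<in> carrier G" "h \<in> carrier G" "g [^] m = h [^] m"
    have "\<gamma> n #> g = \<gamma> n #> h" if "n \<ge> 1" for n
      using that
    proof (induction n rule: dec_induct)
      case base
      show ?case using gh normal.coset_eq_iff[OF lower_central_normal, of g h 1] by simp
    next
      case (step n)
      interpret N: normal "\<gamma> (Suc n)" G by (rule lower_central_normal)
      define z where "z = g \<otimes> inv h"
      have z: "z \<in> \<gamma> n"
        using step(3) gh normal.coset_eq_iff[OF lower_central_normal] z_def by simp
      have z': "z \<in> carrier G" using z lower_central_closed by blast
      have g: "g = z \<otimes> h" using gh by (simp add: z_def m_assoc)
      \<comment> \<open>Since \<open>g [^] m = h [^] m\<close>, cancelling this factor leaves
        \<open>z [^] m\<close> trivial modulo \<open>\<gamma> (Suc n)\<close>.\<close>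
      have "\<gamma> (Suc n) #> (z [^] m \<otimes> h [^] m) = \<gamma> (Suc n) #> (g [^] m)"
        unfolding g
        using N.coset_pow_mult[OF z' gh(2) lower_central_coset_commute[OF step(1) z gh(2)]] by simp
      then have "z [^] m \<in> \<gamma> (Suc n)"
        using gh z' by (simp add: N.coset_eq_iff m_assoc)
      then have "z \<in> \<gamma> (Suc n)" using tf step z by blast
      then show ?case using gh by (simp add: N.coset_eq_iff z_def)
    qed
    then show "g = h" using pronilpotent_separated[OF pn] gh by blast
  qed
  show "(\<lambda>g. g [^] m) ` carrier G = carrier G"
  proof
    have "\<exists>y\<in>\<gamma> 1. y [^] m = w" if "w \<in> \<gamma> 1" for w
      by (rule pronilpotent_root_exists[OF pn _ div that]) auto
    then show "carrier G \<subseteq> (\<lambda>g. g [^] m) ` carrier G"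
      by (auto simp: image_iff)
  qed auto
qed

lemma zero_local_imp_malcev_rat_complete:
  assumes pn: "pronilpotent G" and zl: "zero_local G"
  shows "malcev_rat_complete G"
  unfolding malcev_rat_complete_def
proof (intro conjI allI impI pn)
  fix n :: nat assume n: "n \<ge> 1"
  show "is_rat_vector_space (G\<lparr>carrier := \<gamma> n\<rparr> Mod \<gamma> (n + 1))"
    unfolding lower_central_factor_rat_iff[OF n]
  proof (intro allI impI conjI ballI)
    fix m :: nat assume m: "m \<ge> 1"
    have bij: "bij_betw (\<lambda>g. g [^] m) (carrier G) (carrier G)"
      using zl m by (simp add: zero_local_def)
    have surj: "\<exists>v\<in>carrier G. v [^] m = g" if "g \<in> carrier G" for g
      using bij that unfolding bij_betw_def by (metis (no_types, lifting) imageE)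
    note div = lower_central_factor_divisible[OF surj]
    show "\<exists>z\<in>\<gamma> n. \<gamma> (Suc n) #> (z [^] m) = \<gamma> (Suc n) #> c" if "c \<in> \<gamma> n" for c
      using div n that by blast
    fix z assume z: "z \<in> \<gamma> n" "z [^] m \<in> \<gamma> (Suc n)"
    \<comment> \<open>Roots are taken at level \<open>Suc n\<close>, not \<open>n\<close>: the aim
      is a root lying in \<open>\<gamma> (Suc n)\<close>, which injectivity in \<open>G\<close>
      identifies with \<open>z\<close>.\<close>
    obtain y where y: "y \<in> \<gamma> (Suc n)" "y [^] m = z [^] m"
      using pronilpotent_root_exists[OF pn _ div z(2)] n by auto
    then have "y = z"
      using bij z(1) lower_central_closed unfolding bij_betw_def inj_on_def by metis
    with y(1) show "z \<in> \<gamma> (Suc n)" by simp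
  qed
qed

end

theorem theorem3p2:
  fixes G :: "('a, 'b) monoid_scheme"
  assumes "group G"
  shows "malcev_rat_complete G \<longleftrightarrow> pronilpotent G \<and> zero_local G"
  using assms group.malcev_rat_complete_imp_zero_local group.zero_local_imp_malcev_rat_complete
  by (auto simp: malcev_rat_complete_def)

end
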